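(* Let $\mu$ and $\nu$ be (positive) Borel measures on $\mathbb{R}$, each with finite moments of all orders and infinite support, with orthonormal polynomials $\{p_n\}_{n\ge 0}$ (with respect to $\mu$) and $\{q_n\}_{n\ge 0}$ (with respect to $\nu$) satisfying, for all $n\in\mathbb{Z}_+=\{0,1,2,\ldots\}$, the three-term recurrence relations $$b_n p_{n+1}(x)=(x-a_n)p_n(x)-b_{n-1}p_{n-1}(x),\qquad d_n q_{n+1}(x)=(x-c_n)q_n(x)-d_{n-1}q_{n-1}(x),$$ where $a_n,b_n,c_n,d_n\in\mathbb{R}$, $b_{-1}=d_{-1}=0$, $p_{-1}\equiv q_{-1}\equiv 0$, and $b_n,d_n>0$ for $n\in\mathbb{Z}_+$. Let $\eta$ be a (possibly signed) Borel measure on $\mathbb{R}$ all of whose polynomial moments exist (i.e. every polynomial is $|\eta|$-integrable); $\mu,\nu,\eta$ need not be distinct. Define $$\mathcal{D}_{m,n}=\int_{-\infty}^{\infty}p_m(x)q_n(x)\,\mathrm{d}\eta(x),\qquad m,n\in\mathbb{Z}_+,$$ and $\mathcal{D}_{-1,n}=\mathcal{D}_{m,-1}=0$. Then for all $m,n\in\mathbb{Z}_+$, $$b_{m-1}\mathcal{D}_{m-1,n}+a_m\mathcal{D}_{m,n}+b_m\mathcal{D}_{m+1,n}=d_{n-1}\mathcal{D}_{m,n-1}+c_n\mathcal{D}_{m,n}+d_n\mathcal{D}_{m,n+1}.$$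
   Context: Orthonormal polynomials with respect to $\mu$: $p_n$ is a real polynomial of degree exactly $n$ with $\int p_m p_n\,\mathrm{d}\mu=\delta_{m,n}$; similarly for $q_n$ and $\nu$. Leading coefficients are taken positive, so that $b_n,d_n>0$. *)

theory Defs
  imports "HOL-Analysis.Analysis" "HOL-Computational_Algebra.Polynomial"
begin

section \<open>Signed measures\<close>

text \<open>
  A measure \<open>M\<close> only serves to carry a \<open>\<sigma>\<close>-algebra here.  A signed measure may take the
  value \<open>\<infinity>\<close> or the value \<open>-\<infinity>\<close>, but not both.  The series in the last clause converges for
  every reordering of \<open>A\<close> (the clause also applies to the reordered sequence).
\<close>

definition signed_measure :: "'a measure \<Rightarrow> ('a set \<Rightarrow> ereal) \<Rightarrow> bool" where
  "signed_measure M \<eta> \<longleftrightarrow>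
     \<eta> {} = 0 \<and>
     ((\<forall>A\<in>sets M. \<eta> A \<noteq> \<infinity>) \<or> (\<forall>A\<in>sets M. \<eta> A \<noteq> -\<infinity>)) \<and>
     (\<forall>A :: nat \<Rightarrow> 'a set. range A \<subseteq> sets M \<longrightarrow> disjoint_family A \<longrightarrow>
        (\<lambda>i. \<eta> (A i)) sums \<eta> (\<Union>i. A i))"

text \<open>
  The Jordan decomposition: \<open>\<eta>\<^sup>+(A) = sup {\<eta>(B) | B \<subseteq> A measurable}\<close>, the lower variation \<open>\<eta>\<^sup>-\<close> is
  the upper variation of \<open>-\<eta>\<close>, and \<open>|\<eta>| = \<eta>\<^sup>+ + \<eta>\<^sup>-\<close>.  Since \<open>\<eta>({}) = 0\<close>, the supremum is
  nonnegative, so the truncation of negative values to \<open>0\<close> by \<^const>\<open>e2ennreal\<close> does not change it.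
\<close>

definition upper_variation :: "'a measure \<Rightarrow> ('a set \<Rightarrow> ereal) \<Rightarrow> 'a measure" where
  "upper_variation M \<eta> =
     measure_of (space M) (sets M) (\<lambda>A. SUP B\<in>{B \<in> sets M. B \<subseteq> A}. e2ennreal (\<eta> B))"

definition lower_variation :: "'a measure \<Rightarrow> ('a set \<Rightarrow> ereal) \<Rightarrow> 'a measure" where
  "lower_variation M \<eta> = upper_variation M (\<lambda>A. - \<eta> A)"

definition total_variation :: "'a measure \<Rightarrow> ('a set \<Rightarrow> ereal) \<Rightarrow> 'a measure" where
  "total_variation M \<eta> =
     measure_of (space M) (sets M)
       (\<lambda>A. emeasure (upper_variation M \<eta>) A + emeasure (lower_variation M \<eta>) A)"

text \<open>Only meaningful for functions that are integrable with respect to \<open>|\<eta>|\<close>.\<close>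

definition signed_integral :: "'a measure \<Rightarrow> ('a set \<Rightarrow> ereal) \<Rightarrow> ('a \<Rightarrow> real) \<Rightarrow> real" where
  "signed_integral M \<eta> f =
     (\<integral>x. f x \<partial>upper_variation M \<eta>) - (\<integral>x. f x \<partial>lower_variation M \<eta>)"

text \<open>
  \<^const>\<open>measure_of\<close> yields the zero measure when the given set function is not countably
  additive; the following lemmas show that this does not happen for signed measures.
\<close>

lemma space_upper_variation [simp]: "space (upper_variation M \<eta>) = space M"
  and sets_upper_variation [simp, measurable_cong]: "sets (upper_variation M \<eta>) = sets M"
  by (simp_all add: upper_variation_def sets.space_closed)

lemma space_lower_variation [simp]: "space (lower_variation M \<eta>) = space M"
  and sets_lower_variation [simp, measurable_cong]: "sets (lower_variation M \<eta>) = sets M"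
  by (simp_all add: lower_variation_def)

lemma space_total_variation [simp]: "space (total_variation M \<eta>) = space M"
  and sets_total_variation [simp, measurable_cong]: "sets (total_variation M \<eta>) = sets M"
  by (simp_all add: total_variation_def sets.space_closed)

lemma signed_measure_uminus:
  assumes "signed_measure M \<eta>"
  shows "signed_measure M (\<lambda>A. - \<eta> A)"
proof -
  have fin: "(\<forall>A\<in>sets M. \<eta> A \<noteq> \<infinity>) \<or> (\<forall>A\<in>sets M. \<eta> A \<noteq> -\<infinity>)" and e: "\<eta> {} = 0"
    using assms by (auto simp: signed_measure_def)
  have "(\<lambda>i. - \<eta> (A i)) sums - \<eta> (\<Union>i. A i)"
    if A: "range A \<subseteq> sets M" "disjoint_family A" for A :: "nat \<Rightarrow> _"
  proof -
    have s: "(\<lambda>n. \<Sum>i<n. \<eta> (A i)) \<longlonglongrightarrow> \<eta> (\<Union>i. A i)"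
      using assms A by (auto simp: signed_measure_def sums_def)
    have "(\<Sum>i<n. - \<eta> (A i)) = - (\<Sum>i<n. \<eta> (A i)) \<and>
        ((\<forall>A\<in>sets M. \<eta> A \<noteq> \<infinity>) \<longrightarrow> (\<Sum>i<n. \<eta> (A i)) \<noteq> \<infinity>) \<and>
        ((\<forall>A\<in>sets M. \<eta> A \<noteq> -\<infinity>) \<longrightarrow> (\<Sum>i<n. \<eta> (A i)) \<noteq> -\<infinity>)" for n
    proof (induction n)
      case (Suc n)
      have "A n \<in> sets M" using A by auto
      with Suc fin show ?case
        by (cases "\<eta> (A n)"; cases "\<Sum>i<n. \<eta> (A i)") auto
    qed simp
    then have "(\<lambda>n. \<Sum>i<n. - \<eta> (A i)) = (\<lambda>n. - (\<Sum>i<n. \<eta> (A i)))" by auto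
    then show ?thesis
      using tendsto_uminus_ereal[OF s] by (simp add: sums_def)
  qed
  moreover have "(\<forall>A\<in>sets M. - \<eta> A \<noteq> \<infinity>) \<or> (\<forall>A\<in>sets M. - \<eta> A \<noteq> -\<infinity>)"
    using fin by (auto simp: ereal_uminus_eq_reorder)
  ultimately show ?thesis
    using e by (auto simp: signed_measure_def)
qed

lemma signed_measure_Un:
  assumes \<eta>: "signed_measure M \<eta>" and "A \<in> sets M" "B \<in> sets M" "A \<inter> B = {}"
  shows "\<eta> (A \<union> B) = \<eta> A + \<eta> B"
proof -
  let ?X = "binaryset A B"
  have "range ?X \<subseteq> sets M" "disjoint_family ?X" "(\<Union>i. ?X i) = A \<union> B"
    using assms by (auto simp: range_binaryset_eq UN_binaryset_eq disjoint_family_on_def binaryset_def)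
  then have s: "(\<lambda>i. \<eta> (?X i)) sums \<eta> (A \<union> B)"
    using \<eta> by (metis signed_measure_def)
  have e: "\<eta> {} = 0" using \<eta> by (simp add: signed_measure_def)
  have "(\<lambda>i. \<eta> (?X i)) sums (\<Sum>i<2. \<eta> (?X i))"
    using e by (intro sums_finite) (auto simp: binaryset_def)
  then show ?thesis
    using s sums_unique2 by (fastforce simp: binaryset_def numeral_2_eq_2)
qed

lemma emeasure_upper_variation:
  assumes \<eta>: "signed_measure M \<eta>" and "A \<in> sets M"
  shows "emeasure (upper_variation M \<eta>) A = (SUP B\<in>{B \<in> sets M. B \<subseteq> A}. e2ennreal (\<eta> B))"
proof -
  define f where "f A = (SUP B\<in>{B \<in> sets M. B \<subseteq> A}. e2ennreal (\<eta> B))" for A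
  have e: "\<eta> {} = 0" using \<eta> by (simp add: signed_measure_def)
  have f_upper: "e2ennreal (\<eta> B) \<le> f A" if "B \<in> sets M" "B \<subseteq> A" for A B
    unfolding f_def using that by (intro SUP_upper) auto
  have f_mono: "f A \<le> f B" if "A \<subseteq> B" for A B
    unfolding f_def using that by (intro SUP_subset_mono) auto
  have f_empty: "f {} = 0"
  proof -
    have "{B \<in> sets M. B \<subseteq> {}} = {{}}" by auto
    then show ?thesis by (simp add: f_def e e2ennreal_neg)
  qed
  have f_Un: "f A + f B \<le> f (A \<union> B)" if "A \<inter> B = {}" for A B
  proof -
    have 1: "e2ennreal (\<eta> C) + e2ennreal (\<eta> D) \<le> f (A \<union> B)"
      if C: "C \<in> sets M" "C \<subseteq> A" and D: "D \<in> sets M" "D \<subseteq> B" for C D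
    proof (cases "\<eta> C \<ge> 0 \<and> \<eta> D \<ge> 0")
      case True
      then have "e2ennreal (\<eta> C) + e2ennreal (\<eta> D) = e2ennreal (\<eta> C + \<eta> D)"
        by (metis e2ennreal_enn2ereal enn2ereal_e2ennreal plus_ennreal.rep_eq)
      also have "\<eta> C + \<eta> D = \<eta> (C \<union> D)"
        using C D \<open>A \<inter> B = {}\<close> by (intro signed_measure_Un[OF \<eta>, symmetric]) auto
      also have "e2ennreal \<dots> \<le> f (A \<union> B)"
        using C D by (intro f_upper) auto
      finally show ?thesis .
    next
      case False
      then consider "\<eta> C \<le> 0" | "\<eta> D \<le> 0" by fastforce
      then show ?thesis
      proof cases
        case 1
        then show ?thesis using f_upper[of D "A \<union> B"] D by (simp add: e2ennreal_neg le_supI2)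
      next
        case 2
        then show ?thesis using f_upper[of C "A \<union> B"] C by (simp add: e2ennreal_neg le_supI1)
      qed
    qed
    have ne: "{C \<in> sets M. C \<subseteq> A} \<noteq> {}" "{D \<in> sets M. D \<subseteq> B} \<noteq> {}" by auto
    have 2: "e2ennreal (\<eta> C) + f B \<le> f (A \<union> B)" if C: "C \<in> sets M" "C \<subseteq> A" for C
    proof -
      have "e2ennreal (\<eta> C) + f B =
          (SUP D\<in>{D \<in> sets M. D \<subseteq> B}. e2ennreal (\<eta> C) + e2ennreal (\<eta> D))"
        unfolding f_def by (rule ennreal_SUP_add_right[OF ne(2)])
      also have "\<dots> \<le> f (A \<union> B)"
        by (rule SUP_least) (use 1[OF C] in blast)
      finally show ?thesis .
    qed
    have "f A + f B = (SUP C\<in>{C \<in> sets M. C \<subseteq> A}. e2ennreal (\<eta> C) + f B)"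
      unfolding f_def[of A] by (rule ennreal_SUP_add_left[OF ne(1), symmetric])
    also have "\<dots> \<le> f (A \<union> B)"
      by (rule SUP_least) (use 2 in blast)
    finally show ?thesis .
  qed
  have "countably_additive (sets M) f"
  proof (rule countably_additiveI)
    fix A :: "nat \<Rightarrow> 'a set"
    assume A: "range A \<subseteq> sets M" "disjoint_family A" "(\<Union>i. A i) \<in> sets M"
    have "(\<Sum>i<n. f (A i)) \<le> f (\<Union>i<n. A i)" for n
    proof (induction n)
      case (Suc n)
      have "A i \<inter> A n = {}" if "i < n" for i
        using A(2) that by (simp add: disjoint_family_on_def)
      then have "(\<Union>i<n. A i) \<inter> A n = {}" by blast
      then have "f (\<Union>i<n. A i) + f (A n) \<le> f ((\<Union>i<n. A i) \<union> A n)"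
        by (rule f_Un)
      also have "(\<Union>i<n. A i) \<union> A n = (\<Union>i<Suc n. A i)"
        by (auto simp: lessThan_Suc)
      finally have "f (\<Union>i<n. A i) + f (A n) \<le> f (\<Union>i<Suc n. A i)" .
      moreover have "(\<Sum>i<Suc n. f (A i)) \<le> f (\<Union>i<n. A i) + f (A n)"
        using Suc by (simp add: add_right_mono)
      ultimately show ?case by (rule order_trans[rotated])
    qed (simp add: f_empty)
    moreover have "f (\<Union>i<n. A i) \<le> f (\<Union>i. A i)" for n
      by (intro f_mono) auto
    ultimately have "(\<Sum>i. f (A i)) \<le> f (\<Union>i. A i)"
      by (intro suminf_le_const summableI) (rule order_trans)
    moreover have "f (\<Union>i. A i) \<le> (\<Sum>i. f (A i))"
      unfolding f_def[of "\<Union>i. A i"]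
    proof (rule SUP_least, clarify)
      fix B assume B: "B \<in> sets M" "B \<subseteq> (\<Union>i. A i)"
      have "(\<lambda>i. \<eta> (B \<inter> A i)) sums \<eta> (\<Union>i. B \<inter> A i)"
      proof -
        have "range (\<lambda>i. B \<inter> A i) \<subseteq> sets M" using A(1) B(1) by blast
        moreover have "disjoint_family (\<lambda>i. B \<inter> A i)"
          using A(2) unfolding disjoint_family_on_def by blast
        ultimately show ?thesis using \<eta> unfolding signed_measure_def by blast
      qed
      also have "(\<Union>i. B \<inter> A i) = B" using B by auto
      finally have lim: "(\<lambda>n. \<Sum>i<n. \<eta> (B \<inter> A i)) \<longlonglongrightarrow> \<eta> B" by (simp add: sums_def)
      have "(\<Sum>i<n. \<eta> (B \<inter> A i)) \<le> enn2ereal (\<Sum>i. f (A i))" for n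
      proof -
        have "\<eta> (B \<inter> A i) \<le> enn2ereal (f (A i))" for i
        proof -
          have "e2ennreal (\<eta> (B \<inter> A i)) \<le> f (A i)"
            by (rule f_upper) (use A(1) B(1) in blast)+
          then have "enn2ereal (e2ennreal (\<eta> (B \<inter> A i))) \<le> enn2ereal (f (A i))"
            by (simp add: less_eq_ennreal.rep_eq)
          then show ?thesis
            using enn2ereal_nonneg[of "f (A i)"]
            by (metis enn2ereal_e2ennreal linear order_trans)
        qed
        then have "(\<Sum>i<n. \<eta> (B \<inter> A i)) \<le> (\<Sum>i<n. enn2ereal (f (A i)))"
          by (intro sum_mono)
        also have "\<dots> = enn2ereal (\<Sum>i<n. f (A i))"
          by (simp add: sum_enn2ereal)
        also have "\<dots> \<le> enn2ereal (\<Sum>i. f (A i))"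
          unfolding less_eq_ennreal.rep_eq[symmetric]
          by (intro sum_le_suminf summableI) auto
        finally show ?thesis .
      qed
      then have "\<eta> B \<le> enn2ereal (\<Sum>i. f (A i))"
        by (intro LIMSEQ_le_const2[OF lim]) auto
      then have "e2ennreal (\<eta> B) \<le> e2ennreal (enn2ereal (\<Sum>i. f (A i)))"
        by (rule e2ennreal_mono)
      then show "e2ennreal (\<eta> B) \<le> (\<Sum>i. f (A i))" by simp
    qed
    ultimately show "(\<Sum>i. f (A i)) = f (\<Union>i. A i)" by (rule antisym)
  qed
  moreover have "positive (sets M) f" by (simp add: positive_def f_empty)
  ultimately have "emeasure (upper_variation M \<eta>) A = f A"
    unfolding upper_variation_def f_def[symmetric]
    using \<open>A \<in> sets M\<close> sets.sigma_algebra_axioms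
    by (intro emeasure_measure_of_sigma) auto
  then show ?thesis by (simp add: f_def)
qed

lemma emeasure_lower_variation:
  assumes "signed_measure M \<eta>" and "A \<in> sets M"
  shows "emeasure (lower_variation M \<eta>) A = (SUP B\<in>{B \<in> sets M. B \<subseteq> A}. e2ennreal (- \<eta> B))"
  unfolding lower_variation_def
  using assms by (intro emeasure_upper_variation signed_measure_uminus)

lemma emeasure_total_variation:
  assumes "A \<in> sets M"
  shows "emeasure (total_variation M \<eta>) A =
           emeasure (upper_variation M \<eta>) A + emeasure (lower_variation M \<eta>) A"
  unfolding total_variation_def
proof (rule emeasure_measure_of_sigma)
  show "countably_additive (sets M)
      (\<lambda>A. emeasure (upper_variation M \<eta>) A + emeasure (lower_variation M \<eta>) A)"
    by (intro countably_additiveI) (simp flip: suminf_add add: suminf_emeasure)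
qed (use assms sets.sigma_algebra_axioms in \<open>auto simp: positive_def\<close>)


section \<open>Orthonormal polynomials\<close>

definition measure_support :: "'a::topological_space measure \<Rightarrow> 'a set" where
  "measure_support M = {x. \<forall>U. open U \<longrightarrow> x \<in> U \<longrightarrow> emeasure M U > 0}"

text \<open>
  Sequences are indexed by \<^typ>\<open>int\<close> so that the index \<open>-1\<close> is available; values at smaller indices
  are irrelevant.
\<close>

definition orthonormal_polynomials :: "real measure \<Rightarrow> (int \<Rightarrow> real poly) \<Rightarrow> bool" where
  "orthonormal_polynomials M p \<longleftrightarrow>
     (\<forall>n\<ge>0. degree (p n) = nat n \<and> lead_coeff (p n) > 0) \<and>
     (\<forall>m\<ge>0. \<forall>n\<ge>0. (\<integral>x. poly (p m) x * poly (p n) x \<partial>M) = (if m = n then 1 else 0))"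

end

theory Submission
  imports Defs
begin

text \<open>Write \<open>L\<close> for the linear functional sending a polynomial to its integral
  against \<eta>. Both sides of the identity are the single number \<open>L\<close> of x p_m q_n:
  letting x act on p_m and expanding by its recurrence gives the left side, letting it act on q_n
  gives the right side. Only linearity of \<open>L\<close> has to be established; it comes from
  \<open>signed_integral_add\<close> and \<open>signed_integral_mult_right\<close>, where
  integrability against |\<eta>| passes to both Jordan parts by
  \<open>integrable_variations\<close>.\<close>

lemma integrable_le_measure:
  fixes f :: "'a \<Rightarrow> 'b::{banach, second_countable_topology}"
  assumes "integrable N f" "sets M = sets N" "\<And>A. A \<in> sets M \<Longrightarrow> emeasure M A \<le> emeasure N A"
  shows "integrable M f"
proof -
  have "(\<integral>\<^sup>+x. ennreal (norm (f x)) \<partial>M) \<le> (\<integral>\<^sup>+x. ennreal (norm (f x)) \<partial>N)"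
    using assms(2,3) by (intro nn_integral_mono_measure) (auto simp: le_measure)
  then show ?thesis
    using assms(1) measurable_cong_sets[OF assms(2) refl, of borel]
    by (auto simp: integrable_iff_bounded intro: le_less_trans)
qed

text \<open>Each variation is a summand of the total variation, hence dominated by it on every
  measurable set.\<close>

lemma integrable_variations:
  fixes f :: "'a \<Rightarrow> 'b::{banach, second_countable_topology}"
  assumes "integrable (total_variation M \<eta>) f"
  shows "integrable (upper_variation M \<eta>) f" "integrable (lower_variation M \<eta>) f"
  by (rule integrable_le_measure[OF assms]; simp add: emeasure_total_variation)+

lemma signed_integral_add:
  assumes "integrable (total_variation M \<eta>) f" "integrable (total_variation M \<eta>) g"
  shows "signed_integral M \<eta> (\<lambda>x. f x + g x) = signed_integral M \<eta> f + signed_integral M \<eta> g"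
  using assms[THEN integrable_variations(1)] assms[THEN integrable_variations(2)]
  by (simp add: signed_integral_def)

text \<open>Unlike additivity, this needs no integrability: if a Bochner integral takes its default
  value 0, scaling still commutes with it.\<close>

lemma signed_integral_mult_right:
  "signed_integral M \<eta> (\<lambda>x. c * f x) = c * signed_integral M \<eta> f"
  by (simp add: signed_integral_def right_diff_distrib)

theorem lemma1:
  fixes \<mu> \<nu> :: "real measure"
    and \<eta> :: "real set \<Rightarrow> ereal"
    and p q :: "int \<Rightarrow> real poly"
    and a b c d :: "int \<Rightarrow> real"
    and D :: "int \<Rightarrow> int \<Rightarrow> real"
    and m n :: int
  assumes borel: "sets \<mu> = sets borel" "sets \<nu> = sets borel"
    and moments: "\<And>k::nat. integrable \<mu> (\<lambda>x. x ^ k)" "\<And>k::nat. integrable \<nu> (\<lambda>x. x ^ k)"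
    and support: "infinite (measure_support \<mu>)" "infinite (measure_support \<nu>)"
    and orthonormal: "orthonormal_polynomials \<mu> p" "orthonormal_polynomials \<nu> q"
    and rec_p: "\<And>n x. n \<ge> 0 \<Longrightarrow>
          b n * poly (p (n + 1)) x = (x - a n) * poly (p n) x - b (n - 1) * poly (p (n - 1)) x"
    and rec_q: "\<And>n x. n \<ge> 0 \<Longrightarrow>
          d n * poly (q (n + 1)) x = (x - c n) * poly (q n) x - d (n - 1) * poly (q (n - 1)) x"
    and init: "b (-1) = 0" "d (-1) = 0" "p (-1) = 0" "q (-1) = 0"
    and pos: "\<And>n. n \<ge> 0 \<Longrightarrow> b n > 0" "\<And>n. n \<ge> 0 \<Longrightarrow> d n > 0"
    and signed: "signed_measure borel \<eta>"
    and integrable_\<eta>: "\<And>P :: real poly. integrable (total_variation borel \<eta>) (poly P)"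
    and D: "\<And>m n. m \<ge> 0 \<Longrightarrow> n \<ge> 0 \<Longrightarrow>
          D m n = signed_integral borel \<eta> (\<lambda>x. poly (p m) x * poly (q n) x)"
    and D_init: "\<And>n. n \<ge> 0 \<Longrightarrow> D (-1) n = 0" "\<And>m. m \<ge> 0 \<Longrightarrow> D m (-1) = 0"
    and mn: "m \<ge> 0" "n \<ge> 0"
  shows "b (m - 1) * D (m - 1) n + a m * D m n + b m * D (m + 1) n =
         d (n - 1) * D m (n - 1) + c n * D m n + d n * D m (n + 1)"
proof -
  define L where "L P = signed_integral borel \<eta> (poly P)" for P
  have L_add: "L (P + Q) = L P + L Q" for P Q
    using signed_integral_add[OF integrable_\<eta> integrable_\<eta>, of P Q]
    by (simp add: L_def flip: poly_add)
  have L_smult: "L (smult k P) = k * L P" for k P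
    using signed_integral_mult_right[of borel \<eta> k "poly P"]
    by (simp add: L_def flip: poly_smult)
  have L_0: "L 0 = 0"
    using L_smult[of 0 0] by simp
  \<comment> \<open>Extending the formula to index -1, where both sides vanish, spares a case split
    on m = 0 or n = 0. The corner (-1, -1) is excluded because the value of \<open>D\<close> there
    is unconstrained.\<close>
  have D_L: "D i j = L (p i * q j)" if "i \<ge> -1" "j \<ge> -1" "i \<ge> 0 \<or> j \<ge> 0" for i j
  proof (cases "i = -1 \<or> j = -1")
    case True
    then show ?thesis using that D_init init L_0 by auto
  next
    case False
    then have "i \<ge> 0" "j \<ge> 0" using that by auto
    then show ?thesis by (simp add: D L_def flip: poly_mult)
  qed
  \<comment> \<open>The recurrence solved for x p_m. It is given pointwise; over the reals, equal
    polynomial functions are equal polynomials.\<close>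
  have xp: "[:0, 1:] * p m = smult (b (m - 1)) (p (m - 1)) + smult (a m) (p m) + smult (b m) (p (m + 1))"
    by (subst poly_eq_poly_eq_iff [symmetric], rule ext) (use rec_p[OF mn(1)] in \<open>simp add: algebra_simps\<close>)
  have xq: "[:0, 1:] * q n = smult (d (n - 1)) (q (n - 1)) + smult (c n) (q n) + smult (d n) (q (n + 1))"
    by (subst poly_eq_poly_eq_iff [symmetric], rule ext) (use rec_q[OF mn(2)] in \<open>simp add: algebra_simps\<close>)
  have "b (m - 1) * D (m - 1) n + a m * D m n + b m * D (m + 1) n = L ([:0, 1:] * p m * q n)"
    unfolding xp using mn by (simp add: D_L L_add L_smult distrib_right)
  \<comment> \<open>The crux: the factor x moves from p_m to q_n.\<close>
  also have "[:0, 1:] * p m * q n = p m * ([:0, 1:] * q n)"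
    by (simp only: mult_ac)
  also have "L \<dots> = d (n - 1) * D m (n - 1) + c n * D m n + d n * D m (n + 1)"
    unfolding xq using mn by (simp add: D_L L_add L_smult distrib_left)
  finally show ?thesis .
qed

end
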